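(* Let $k$ be a field of characteristic zero, let $A$ be an associative unital $k$-algebra, let $\phi:A\to k$ be a unital linear map, and let $\Phi:\overline T(T(A))\to k$ be its multiplicative extension. Let $\kappa:\overline T(T(A))\to k$ be the infinitesimal character solving $\Phi=e+\kappa\prec\Phi$. Then for all $n\geq 1$ and $a_1,\dots,a_n\in A$, $$\kappa(a_1\cdots a_n)=R(a_1,\dots,a_n),$$ where $R$ denotes the generalized non-crossing cumulants associated to $\phi$. That is, the infinitesimal character $\kappa$ computes the generalized non-crossing cumulants associated to $\phi$.
   Context: **The bialgebra.** $T(A):=\bigoplus_{n>0}A^{\otimes n}$, with elements written as words $a_1\cdots a_n$. $T(T(A)):=\bigoplus_{n>0}T(A)^{\otimes n}$ and $\overline T(T(A)):=\bigoplus_{n\ge0}T(A)^{\otimes n}=T(T(A))\oplus k\mathbf 1$, with elements written with bars $w_1|\cdots|w_n$ ($w_i\in T(A)$); the product is bar-concatenation. For a word $a_1\cdots a_n$ and $S=\{s_1<\cdots<s_p\}\subseteq[n]=\{1,\dots,n\}$, put $a_S:=a_{s_1}\cdots a_{s_p}$, $a_\emptyset:=\mathbf 1$. Let $J_1,\dots,J_r$ be the maximal runs of consecutive integers in $[n]-S$, in increasing order; put $a_{J^S_{[n]}}:=a_{J_1}|\cdots|a_{J_r}$ (equal to $\mathbf 1$ if $S=[n]$). The coproduct is $\Delta(a_1\cdots a_n):=\sum_{S\subseteq[n]}a_S\otimes a_{J^S_{[n]}}$, extended by $\Delta(w_1|\cdots|w_m):=\Delta(w_1)\cdots\Delta(w_m)$,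 $\Delta(\mathbf 1)=\mathbf 1\otimes\mathbf 1$. Further $\Delta^+_\prec(a_1\cdots a_n):=\sum_{1\in S\subseteq[n]}a_S\otimes a_{J^S_{[n]}}$, $\Delta^+_\prec(w_1|\cdots|w_m):=\Delta^+_\prec(w_1)\Delta(w_2)\cdots\Delta(w_m)$, and $\Delta_\prec(b):=\Delta^+_\prec(b)-b\otimes\mathbf 1$ for $b\in T(T(A))$. **Half-convolution.** $e:\overline T(T(A))\to k$ is the augmentation (identity on $T(A)^{\otimes 0}=k$, zero on $T(T(A))$). For linear forms $f,g$ on $\overline T(T(A))$ vanishing on $\mathbf 1$, $f\prec g$ vanishes on $\mathbf 1$ and equals $m_k\circ(f\otimes g)\circ\Delta_\prec$ on $T(T(A))$ ($m_k$ the product of $k$); also $f\prec e:=f$, extended linearly. Thus for $f(\mathbf 1)=0$, $g(\mathbf 1)=1$, $f\prec g=m_k\circ(f\otimes g)\circ\Delta^+_\prec$ on $T(T(A))$. **Extension of $\phi$.** $\phi$ is extended to $T(A)$ by $\phi(a_1a_2\cdots a_n):=\phi(a_1\cdot_A a_2\cdot_A\cdots\cdot_A a_n)$, where $\cdot_A$ is the product in $A$, and then $\Phi(\mathbf 1):=1$, $\Phi(w_1|\cdots|w_m):=\phi(w_1)\cdots\phi(w_m)$. **Infinitesimal character.** A linear form $\kappa$ on $\overline T(T(A))$ with $\kappa(\mathbf 1)=0$ and $\kappa(b|c)=0$ for all $b,c\in T(T(A))$. For every such $\Phi$ there is a unique infinitesimal character $\kappa$ with $\Phi=e+\kappa\prec\Phi$.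 **Non-crossing cumulants.** A set partition $\pi=\{P_1,\dots,P_r\}$ of $[n]$ is non-crossing if there are no $i<j<l<m$ in $[n]$ with $i,l$ in one block and $j,m$ in a different block. $NC(n)$ is the set of non-crossing partitions of $[n]$. For a linear form $\mu$ on $T(A)$ and $\pi=\{P_1,\dots,P_r\}\in NC(n)$, $\mu^\pi(a_1,\dots,a_n):=\prod_{i=1}^r\mu(a_{P_i})$. The generalized non-crossing cumulants associated to $\phi$ are the multilinear maps $R(a_1,\dots,a_n)$ (equivalently a linear form on $T(A)$) defined recursively by the implicit equations $$\phi(a_1\cdots a_n)=\sum_{\pi\in NC(n)}R^\pi(a_1,\dots,a_n),\qquad n\ge1.$$ *)

theory Defs
  imports Complex_Main "HOL-Library.Poly_Mapping" "HOL-Library.Disjoint_Sets"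
begin

locale unital_algebra = vector_space scale
  for scale :: "'k::field \<Rightarrow> 'a::ring_1 \<Rightarrow> 'a" +
  assumes scale_mult_left: "scale c x * y = scale c (x * y)"
    and scale_mult_right: "x * scale c y = scale c (x * y)"

text \<open>The type \<open>'b \<Rightarrow>\<^sub>0 'k\<close> is the \<open>'k\<close>-vector space with basis \<open>'b\<close>.\<close>

definition basis :: "'b \<Rightarrow> ('b \<Rightarrow>\<^sub>0 'k::field)" where
  "basis b = Poly_Mapping.single b 1"

definition smult :: "'k::field \<Rightarrow> ('b \<Rightarrow>\<^sub>0 'k) \<Rightarrow> ('b \<Rightarrow>\<^sub>0 'k)" where
  "smult c x = Poly_Mapping.map ((*) c) x"

lemma lookup_smult: "Poly_Mapping.lookup (smult c x) b = c * Poly_Mapping.lookup x b"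
  unfolding smult_def by (simp add: Poly_Mapping.map.rep_eq when_def)

lemma vector_space_smult: "vector_space (smult :: 'k::field \<Rightarrow> ('b \<Rightarrow>\<^sub>0 'k) \<Rightarrow> _)"
  by unfold_locales
    (auto intro!: poly_mapping_eqI simp: lookup_smult lookup_add algebra_simps)

definition lin_ext :: "('k::field \<Rightarrow> 'v \<Rightarrow> 'v) \<Rightarrow> ('b \<Rightarrow> 'v::ab_group_add) \<Rightarrow> ('b \<Rightarrow>\<^sub>0 'k) \<Rightarrow> 'v" where
  "lin_ext s h x = (\<Sum>b\<in>Poly_Mapping.keys x. s (Poly_Mapping.lookup x b) (h b))"

definition bilin_ext ::
  "('b \<Rightarrow> 'b \<Rightarrow> 'b) \<Rightarrow> ('b \<Rightarrow>\<^sub>0 'k::field) \<Rightarrow> ('b \<Rightarrow>\<^sub>0 'k) \<Rightarrow> ('b \<Rightarrow>\<^sub>0 'k)" where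
  "bilin_ext opr x y = lin_ext smult (\<lambda>p. lin_ext smult (\<lambda>q. basis (opr p q)) y) x"

typedef 'a word = "{as :: 'a list. as \<noteq> []}"
  morphisms letters word
  by (rule exI[of _ "[undefined]"]) simp

text \<open>
  \<open>T(A)\<close> is the space \<open>'a word \<Rightarrow>\<^sub>0 'k\<close> of formal combinations of words, modulo multilinearity in
  the letters. Since tensor products distribute over direct sums, the augmented space
  of \<open>T(T(A))\<close> is the space \<open>'a word list \<Rightarrow>\<^sub>0 'k\<close> of formal combinations of bar words
  \<open>w\<^sub>1|\<dots>|w\<^sub>m\<close> with \<open>m \<ge> 0\<close>, modulo multilinearity in all the letters; the empty list is
  the unit \<open>\<one>\<close>. The quotients depend on the scalar multiplication of \<open>A\<close>, so they cannot be
  types. Instead, a linear form on a quotient is a linear form on the free space that kills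
  the relations.

  For an operation \<open>\<iota>\<close> placing a word in a larger basis element, the generators of the
  relations are as follows.
\<close>

definition multilin_rels ::
  "('k::field \<Rightarrow> 'a::ring_1 \<Rightarrow> 'a) \<Rightarrow> ('a word \<Rightarrow> 'b) \<Rightarrow> ('b \<Rightarrow>\<^sub>0 'k) set" where
  "multilin_rels scale \<iota> =
     {basis (\<iota> (word (p @ [x + y] @ q))) - basis (\<iota> (word (p @ [x] @ q)))
        - basis (\<iota> (word (p @ [y] @ q))) | p q x y. True}
   \<union> {basis (\<iota> (word (p @ [scale c x] @ q))) - smult c (basis (\<iota> (word (p @ [x] @ q))))
        | p q c x. True}"

definition linear_form_T ::
  "('k::field \<Rightarrow> 'a::ring_1 \<Rightarrow> 'a) \<Rightarrow> (('a word \<Rightarrow>\<^sub>0 'k) \<Rightarrow> 'k) \<Rightarrow> bool" where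
  "linear_form_T scale f \<longleftrightarrow> Vector_Spaces.linear smult (*) f \<and>
     (\<forall>r\<in>multilin_rels scale (\<lambda>w. w). f r = 0)"

definition linear_form_TT ::
  "('k::field \<Rightarrow> 'a::ring_1 \<Rightarrow> 'a) \<Rightarrow> (('a word list \<Rightarrow>\<^sub>0 'k) \<Rightarrow> 'k) \<Rightarrow> bool" where
  "linear_form_TT scale f \<longleftrightarrow> Vector_Spaces.linear smult (*) f \<and>
     (\<forall>us vs. \<forall>r\<in>multilin_rels scale (\<lambda>w. us @ [w] @ vs). f r = 0)"

text \<open>\<open>T(T(A))\<close> inside its augmentation, and the bar-concatenation product \<open>b|c\<close>.\<close>

definition TT :: "('a word list \<Rightarrow>\<^sub>0 'k::field) set" where
  "TT = {x. Poly_Mapping.lookup x [] = 0}"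

definition bar_conc ::
  "('a word list \<Rightarrow>\<^sub>0 'k::field) \<Rightarrow> ('a word list \<Rightarrow>\<^sub>0 'k) \<Rightarrow> ('a word list \<Rightarrow>\<^sub>0 'k)" where
  "bar_conc = bilin_ext (@)"

text \<open>
  Positions in a word are numbered from \<open>0\<close>: the set \<open>[n]\<close> is \<open>{..<n}\<close>, the first letter has
  index \<open>0\<close>, and \<open>a\<^sub>S\<close> is \<open>nths as S\<close>. The tensor square is the free
  space on pairs of bar words, \<open>(u, v)\<close> standing for \<open>u \<otimes> v\<close>.
\<close>

definition subword :: "'a list \<Rightarrow> nat set \<Rightarrow> 'a word list" where
  "subword as S = (if nths as S = [] then [] else [word (nths as S)])"

definition run_starts :: "nat set \<Rightarrow> nat set" where
  "run_starts X = {i \<in> X. i = 0 \<or> i - 1 \<notin> X}"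

definition run_from :: "nat set \<Rightarrow> nat \<Rightarrow> nat set" where
  "run_from X i = {j. i \<le> j \<and> {i..j} \<subseteq> X}"

text \<open>The maximal runs of consecutive integers in a finite set, in increasing order.\<close>

definition runs :: "nat set \<Rightarrow> nat set list" where
  "runs X = map (run_from X) (sorted_list_of_set (run_starts X))"

definition subword_tensor :: "'a list \<Rightarrow> nat set \<Rightarrow> 'a word list \<times> 'a word list" where
  "subword_tensor as S =
     (subword as S, map (\<lambda>J. word (nths as J)) (runs ({..<length as} - S)))"

definition tensor_mult ::
  "('a word list \<times> 'a word list \<Rightarrow>\<^sub>0 'k::field) \<Rightarrow> ('a word list \<times> 'a word list \<Rightarrow>\<^sub>0 'k)
    \<Rightarrow> ('a word list \<times> 'a word list \<Rightarrow>\<^sub>0 'k)" where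
  "tensor_mult = bilin_ext (\<lambda>(u, v) (u', v'). (u @ u', v @ v'))"

definition Delta_word :: "'a word \<Rightarrow> ('a word list \<times> 'a word list \<Rightarrow>\<^sub>0 'k::field)" where
  "Delta_word w = (\<Sum>S\<in>Pow {..<length (letters w)}. basis (subword_tensor (letters w) S))"

definition Delta_plus_word :: "'a word \<Rightarrow> ('a word list \<times> 'a word list \<Rightarrow>\<^sub>0 'k::field)" where
  "Delta_plus_word w =
     (\<Sum>S | 0 \<in> S \<and> S \<subseteq> {..<length (letters w)}. basis (subword_tensor (letters w) S))"

fun Delta_bar :: "'a word list \<Rightarrow> ('a word list \<times> 'a word list \<Rightarrow>\<^sub>0 'k::field)" where
  "Delta_bar [] = basis ([], [])"
| "Delta_bar (w # ws) = tensor_mult (Delta_word w) (Delta_bar ws)"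

text \<open>
  The half-coproducts are only meaningful on \<open>T(T(A))\<close>; their value on \<open>\<one>\<close> is set to \<open>0\<close>.
\<close>

fun Delta_plus_bar :: "'a word list \<Rightarrow> ('a word list \<times> 'a word list \<Rightarrow>\<^sub>0 'k::field)" where
  "Delta_plus_bar [] = 0"
| "Delta_plus_bar (w # ws) = tensor_mult (Delta_plus_word w) (Delta_bar ws)"

definition Delta_prec ::
  "('a word list \<Rightarrow>\<^sub>0 'k::field) \<Rightarrow> ('a word list \<times> 'a word list \<Rightarrow>\<^sub>0 'k)" where
  "Delta_prec = lin_ext smult (\<lambda>b. if b = [] then 0 else Delta_plus_bar b - basis (b, []))"

definition augmentation :: "('a word list \<Rightarrow>\<^sub>0 'k::field) \<Rightarrow> 'k" where
  "augmentation x = Poly_Mapping.lookup x []"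

text \<open>\<open>m\<^sub>k \<circ> (f \<otimes> g)\<close>\<close>

definition tensor_form ::
  "(('a word list \<Rightarrow>\<^sub>0 'k::field) \<Rightarrow> 'k) \<Rightarrow> (('a word list \<Rightarrow>\<^sub>0 'k) \<Rightarrow> 'k)
    \<Rightarrow> ('a word list \<times> 'a word list \<Rightarrow>\<^sub>0 'k) \<Rightarrow> 'k" where
  "tensor_form f g = lin_ext (*) (\<lambda>(u, v). f (basis u) * g (basis v))"

text \<open>
  \<open>half_conv0\<close> is the half-convolution of linear forms vanishing on \<open>\<one>\<close>. A form \<open>g\<close> is the sum
  of \<open>g - g(\<one>) e\<close>, which vanishes on \<open>\<one>\<close>, and of \<open>g(\<one>) e\<close>; \<open>half_conv\<close> extends \<open>half_conv0\<close>
  linearly in \<open>g\<close> by \<open>f \<prec> e = f\<close>.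
\<close>

definition half_conv0 ::
  "(('a word list \<Rightarrow>\<^sub>0 'k::field) \<Rightarrow> 'k) \<Rightarrow> (('a word list \<Rightarrow>\<^sub>0 'k) \<Rightarrow> 'k)
    \<Rightarrow> ('a word list \<Rightarrow>\<^sub>0 'k) \<Rightarrow> 'k" where
  "half_conv0 f g x = tensor_form f g (Delta_prec x)"

definition half_conv ::
  "(('a word list \<Rightarrow>\<^sub>0 'k::field) \<Rightarrow> 'k) \<Rightarrow> (('a word list \<Rightarrow>\<^sub>0 'k) \<Rightarrow> 'k)
    \<Rightarrow> ('a word list \<Rightarrow>\<^sub>0 'k) \<Rightarrow> 'k" where
  "half_conv f g x =
     half_conv0 f (\<lambda>y. g y - g (basis []) * augmentation y) x + g (basis []) * f x"

definition infinitesimal_character ::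
  "('k::field \<Rightarrow> 'a::ring_1 \<Rightarrow> 'a) \<Rightarrow> (('a word list \<Rightarrow>\<^sub>0 'k) \<Rightarrow> 'k) \<Rightarrow> bool" where
  "infinitesimal_character scale \<kappa> \<longleftrightarrow> linear_form_TT scale \<kappa> \<and> \<kappa> (basis []) = 0 \<and>
     (\<forall>b\<in>TT. \<forall>c\<in>TT. \<kappa> (bar_conc b c) = 0)"

definition ext_T :: "('a::ring_1 \<Rightarrow> 'k::field) \<Rightarrow> ('a word \<Rightarrow>\<^sub>0 'k) \<Rightarrow> 'k" where
  "ext_T \<phi> = lin_ext (*) (\<lambda>w. \<phi> (prod_list (letters w)))"

definition ext_TT :: "('a::ring_1 \<Rightarrow> 'k::field) \<Rightarrow> ('a word list \<Rightarrow>\<^sub>0 'k) \<Rightarrow> 'k" where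
  "ext_TT \<phi> = lin_ext (*) (\<lambda>ws. \<Prod>w\<leftarrow>ws. ext_T \<phi> (basis w))"

definition noncrossing :: "nat set set \<Rightarrow> bool" where
  "noncrossing \<pi> \<longleftrightarrow> \<not> (\<exists>i j l m. i < j \<and> j < l \<and> l < m \<and>
     (\<exists>P\<in>\<pi>. \<exists>Q\<in>\<pi>. P \<noteq> Q \<and> i \<in> P \<and> l \<in> P \<and> j \<in> Q \<and> m \<in> Q))"

definition NC :: "nat \<Rightarrow> nat set set set" where
  "NC n = {\<pi>. partition_on {..<n} \<pi> \<and> noncrossing \<pi>}"

definition partition_form ::
  "(('a word \<Rightarrow>\<^sub>0 'k::field) \<Rightarrow> 'k) \<Rightarrow> nat set set \<Rightarrow> 'a list \<Rightarrow> 'k" where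
  "partition_form \<mu> \<pi> as = (\<Prod>P\<in>\<pi>. \<mu> (basis (word (nths as P))))"

definition noncrossing_cumulants ::
  "('k::field \<Rightarrow> 'a::ring_1 \<Rightarrow> 'a) \<Rightarrow> ('a \<Rightarrow> 'k) \<Rightarrow> (('a word \<Rightarrow>\<^sub>0 'k) \<Rightarrow> 'k) \<Rightarrow> bool" where
  "noncrossing_cumulants scale \<phi> R \<longleftrightarrow> linear_form_T scale R \<and>
     (\<forall>as. as \<noteq> [] \<longrightarrow>
        ext_T \<phi> (basis (word as)) = (\<Sum>\<pi>\<in>NC (length as). partition_form R \<pi> as))"

end

theory Submission imports Defs begin

text \<open>
  Write \<open>M(a\<^sub>1\<dots>a\<^sub>n)\<close> for the moment \<open>\<phi>(a\<^sub>1 \<cdots> a\<^sub>n)\<close>. Both \<open>\<kappa>\<close> and \<open>R\<close> solve one and the same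
  recursion in an unknown form \<open>f\<close> on words,
  \<open>M(a\<^sub>1\<dots>a\<^sub>n) = \<Sum>\<^sub>S f(a\<^sub>S) M(a\<^sub>J\<^sub>1) \<cdots> M(a\<^sub>J\<^sub>r)\<close>,
  where \<open>S\<close> ranges over the sets of positions containing the first one and \<open>J\<^sub>1, \<dots>, J\<^sub>r\<close> are the
  maximal runs of the complement of \<open>S\<close>. The term for the full set \<open>S\<close> is \<open>f(a\<^sub>1\<dots>a\<^sub>n)\<close>, and all
  the other terms involve \<open>f\<close> on strictly shorter words only, so induction on the length shows
  that the recursion has at most one solution (\<open>first_block_recursion_unique\<close>).

  For \<open>\<kappa>\<close> the recursion is the fixed point equation \<open>\<Phi> = e + \<kappa> \<prec> \<Phi>\<close> evaluated on a single word:
  the half-coproduct of a word is indexed by exactly these sets \<open>S\<close>, and \<open>\<Phi>\<close> is multiplicative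
  on the bar word of the runs (\<open>half_conv_recursion\<close>).

  For \<open>R\<close> it comes from grouping the non-crossing partitions by the block \<open>S\<close> of the first letter
  (\<open>cumulant_recursion\<close>). Another block cannot jump over an element \<open>s\<close> of \<open>S\<close>, since it would then
  cross \<open>S\<close> at the first position and \<open>s\<close>; hence it lies within a run of the complement
  (\<open>NC_insert_iff\<close>). Conversely, non-crossing partitions of the single runs can be chosen
  independently, so the sum over them factors over the runs (\<open>sum_NC_refining\<close>), and each factor
  is the moment of the subword on that run.
\<close>

section \<open>Runs of a finite set of positions\<close>

lemma run_from_convex:
  assumes "x \<in> run_from X i" "y \<in> run_from X i" "x \<le> z" "z \<le> y"
  shows "z \<in> X"
  using assms by (auto simp: run_from_def)

lemma run_from_subset: "run_from X i \<subseteq> X"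
  by (auto simp: run_from_def)

lemma run_start_in_run: "i \<in> run_starts X \<Longrightarrow> i \<in> run_from X i"
  by (auto simp: run_from_def run_starts_def)

text \<open>
  It is this interval shape that lets a partition of a run be shifted down to a partition of an
  initial segment.
\<close>

lemma run_from_eq_interval:
  assumes "finite X"
  shows "\<exists>j. run_from X i = {i..<j}"
proof -
  define j where "j = (LEAST m. i \<le> m \<and> m \<notin> X)"
  have "\<exists>m. i \<le> m \<and> m \<notin> X"
    using assms by (meson finite_nat_set_iff_bounded_le linorder_not_less nat_le_linear not_less_eq_eq)
  then have j: "i \<le> j" "j \<notin> X"
    unfolding j_def by (metis (mono_tags, lifting) LeastI)+
  have below: "m \<in> X" if "i \<le> m" "m < j" for m
    using that not_less_Least[of m "\<lambda>m. i \<le> m \<and> m \<notin> X"] by (auto simp: j_def)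
  have "run_from X i = {i..<j}"
    using j by (auto simp: run_from_def below subset_iff)
  then show ?thesis ..
qed

lemma Union_runs: "\<Union>(run_from X ` run_starts X) = X"
proof
  show "X \<subseteq> \<Union>(run_from X ` run_starts X)"
  proof
    fix x assume "x \<in> X"
    \<comment> \<open>The start of the run of \<open>x\<close>: the furthest point reachable to the left within \<open>X\<close>.\<close>
    define i where "i = (LEAST i. {i..x} \<subseteq> X \<and> i \<le> x)"
    have i: "{i..x} \<subseteq> X \<and> i \<le> x"
      unfolding i_def using \<open>x \<in> X\<close>
      by (intro LeastI[of "\<lambda>i. {i..x} \<subseteq> X \<and> i \<le> x" x]) simp
    have "i - 1 \<notin> X" if "i \<noteq> 0"
    proof
      assume "i - 1 \<in> X"
      then have "{i - 1..x} \<subseteq> X"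
        using i that atLeastAtMost_insertL[of "i - 1" x, symmetric] by auto
      then show False
        using i that not_less_Least[of "i - 1" "\<lambda>i. {i..x} \<subseteq> X \<and> i \<le> x"]
        by (auto simp: i_def)
    qed
    with i have "i \<in> run_starts X" "x \<in> run_from X i"
      by (auto simp: run_starts_def run_from_def)
    then show "x \<in> \<Union>(run_from X ` run_starts X)" by blast
  qed
qed (auto simp: run_from_def)

lemma run_starts_empty_iff: "run_starts X = {} \<longleftrightarrow> X = {}"
proof
  assume "run_starts X = {}"
  then have "\<Union>(run_from X ` run_starts X) = {}" by simp
  then show "X = {}" by (simp only: Union_runs)
qed (simp add: run_starts_def)

text \<open>
  If a run contained a point at or beyond a later run start, it would contain the position just
  before that start, which is outside \<open>X\<close>.
\<close>

lemma runs_ordered: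
  assumes "i' \<in> run_starts X" "i < i'" "x \<in> run_from X i" "y \<in> run_from X i'"
  shows "x < y"
proof (rule ccontr)
  assume "\<not> x < y"
  with assms have "i' \<le> x" by (auto simp: run_from_def)
  with assms have "i' - 1 \<in> {i..x}" "{i..x} \<subseteq> X" by (auto simp: run_from_def)
  then have "i' - 1 \<in> X" by blast
  with assms show False by (auto simp: run_starts_def)
qed

lemma inj_on_run_from: "inj_on (run_from X) (run_starts X)"
  by (rule inj_onI) (metis runs_ordered linorder_neqE_nat order_less_irrefl run_start_in_run)

lemma finite_run_starts: "finite X \<Longrightarrow> finite (run_starts X)"
  by (simp add: run_starts_def)

lemma prod_list_runs:
  fixes f :: "nat set \<Rightarrow> 'k::comm_monoid_mult"
  assumes "finite X"
  shows "(\<Prod>J\<leftarrow>runs X. f J) = (\<Prod>J\<in>run_from X ` run_starts X. f J)"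
proof -
  have "distinct (runs X)" "set (runs X) = run_from X ` run_starts X"
    using assms by (simp_all add: runs_def distinct_map finite_run_starts inj_on_run_from)
  then show ?thesis
    by (metis prod.distinct_set_conv_list)
qed

section \<open>Evaluating the half-convolution on a single word\<close>

lemma lin_ext_basis:
  assumes "s 1 (h b) = h b"
  shows "lin_ext s h (basis b) = h b"
  using assms by (simp add: lin_ext_def basis_def)

lemma lin_ext_mult_add:
  "lin_ext (*) h (x + y) = lin_ext (*) h x + (lin_ext (*) h y :: 'k::field)"
  unfolding lin_ext_def by (rule setsum_keys_plus_distrib) (simp_all add: algebra_simps)

lemma lin_ext_mult_diff:
  "lin_ext (*) h (x - y) = lin_ext (*) h x - (lin_ext (*) h y :: 'k::field)"
  using lin_ext_mult_add[of h "x - y" y] by simp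

lemma lin_ext_mult_sum:
  "lin_ext (*) h (\<Sum>i\<in>I. x i) = (\<Sum>i\<in>I. lin_ext (*) h (x i) :: 'k::field)"
proof (induction I rule: infinite_finite_induct)
  case (insert i I)
  then show ?case by (simp add: lin_ext_mult_add)
qed (simp_all add: lin_ext_def)

lemma lin_ext_smult_basis: "lin_ext smult basis x = x"
proof (rule poly_mapping_eqI)
  fix c
  have "Poly_Mapping.lookup (lin_ext smult basis x) c =
      (\<Sum>b\<in>Poly_Mapping.keys x. if b = c then Poly_Mapping.lookup x b else 0)"
    unfolding lin_ext_def lookup_sum
    by (intro sum.cong refl) (simp add: lookup_smult basis_def lookup_single)
  also have "\<dots> = Poly_Mapping.lookup x c"
    by (simp add: in_keys_iff)
  finally show "Poly_Mapping.lookup (lin_ext smult basis x) c = Poly_Mapping.lookup x c" .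
qed

lemma smult_one: "smult 1 x = x"
  by (rule poly_mapping_eqI) (simp add: lookup_smult)

lemma tensor_mult_one_right: "tensor_mult x (basis ([], [])) = x"
  by (simp add: tensor_mult_def bilin_ext_def lin_ext_basis smult_one case_prod_unfold
      lin_ext_smult_basis)

lemma tensor_form_basis: "tensor_form f g (basis (u, v)) = f (basis u) * g (basis v)"
  by (simp add: tensor_form_def lin_ext_basis)

text \<open>
  The form \<open>g - e\<close> vanishes on \<open>\<one>\<close>, so convolving with it loses the summand of the full set of
  positions, which is \<open>f w\<close>; the part \<open>f \<prec> e = f\<close> of \<open>f \<prec> g\<close> puts it back.
\<close>

lemma half_conv_single_word:
  assumes "g (basis []) = 1"
  shows "half_conv f g (basis [w]) =
    (\<Sum>S | 0 \<in> S \<and> S \<subseteq> {..<length (letters w)}.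
      f (basis (fst (subword_tensor (letters w) S))) *
      g (basis (snd (subword_tensor (letters w) S))))" (is "_ = (\<Sum>S\<in>?I. ?f S * ?g S)")
proof -
  let ?n = "length (letters w)"
  let ?u = "\<lambda>S. snd (subword_tensor (letters w) S)"
  define g0 where "g0 = (\<lambda>y. g y - g (basis []) * augmentation y)"
  have nonempty: "letters w \<noteq> []"
    using letters[of w] by simp
  have fin: "finite ?I"
    by (rule finite_subset[of _ "Pow {..<?n}"]) auto
  have full: "{..<?n} \<in> ?I"
    using nonempty by auto
  have g0: "g0 (basis v) = g (basis v) - (if v = [] then 1 else 0)" for v
    using assms by (simp add: g0_def augmentation_def basis_def lookup_single when_def)
  have unit: "?u S = [] \<longleftrightarrow> S = {..<?n}" if "S \<in> ?I" for S
  proof -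
    let ?X = "{..<?n} - S"
    have "?u S = [] \<longleftrightarrow> run_starts ?X = {}"
      by (simp add: subword_tensor_def runs_def run_starts_def)
    also have "\<dots> \<longleftrightarrow> ?X = {}"
      by (rule run_starts_empty_iff)
    finally show ?thesis using that by auto
  qed
  have full_word: "?f {..<?n} = f (basis [w])"
    using nonempty by (simp add: subword_tensor_def subword_def letters_inverse)
  have "half_conv0 f g0 (basis [w]) =
      tensor_form f g0 (Delta_plus_word w - basis ([w], []))"
    by (simp add: half_conv0_def Delta_prec_def lin_ext_basis smult_one tensor_mult_one_right)
  also have "\<dots> = (\<Sum>S\<in>?I. ?f S * g0 (basis (?u S)))"
    by (simp add: tensor_form_def lin_ext_mult_diff Delta_plus_word_def lin_ext_mult_sum
        lin_ext_basis case_prod_unfold g0 assms)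
  also have "\<dots> = (\<Sum>S\<in>?I. ?f S * ?g S - (if S = {..<?n} then ?f S else 0))"
    by (intro sum.cong refl) (simp add: g0 unit algebra_simps)
  also have "\<dots> = (\<Sum>S\<in>?I. ?f S * ?g S) - f (basis [w])"
    using fin full by (simp add: sum_subtractf full_word)
  finally show ?thesis
    by (simp add: half_conv_def g0_def assms)
qed

section \<open>Non-crossing partitions of finite sets of positions\<close>

text \<open>
  The blocks other than that of the first letter form partitions of arbitrary intervals, which need
  not start at position \<open>0\<close>.
\<close>

definition NC_on :: "nat set \<Rightarrow> nat set set set" where
  "NC_on X = {\<pi>. partition_on X \<pi> \<and> noncrossing \<pi>}"

lemma NC_eq_NC_on: "NC n = NC_on {..<n}"
  by (simp add: NC_def NC_on_def)

lemma finite_NC_on: "finite X \<Longrightarrow> finite (NC_on X)"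
  unfolding NC_on_def using finitely_many_partition_on[of X] by (auto intro: rev_finite_subset)

lemma noncrossingD:
  assumes "noncrossing \<pi>" "P \<in> \<pi>" "Q \<in> \<pi>" "i \<in> P" "l \<in> P" "j \<in> Q" "m \<in> Q" "i < j" "j < l" "l < m"
  shows "P = Q"
  using assms unfolding noncrossing_def by blast

lemma noncrossing_mono: "noncrossing \<pi> \<Longrightarrow> \<pi>' \<subseteq> \<pi> \<Longrightarrow> noncrossing \<pi>'"
  unfolding noncrossing_def by blast

lemma partition_block_unique:
  assumes "partition_on X \<pi>" "P \<in> \<pi>" "Q \<in> \<pi>" "x \<in> P" "x \<in> Q"
  shows "P = Q"
  using assms by (auto simp: partition_on_def disjoint_def)

lemma sum_NC_on_shift:
  fixes f :: "nat set \<Rightarrow> 'k::comm_semiring_1"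
  shows "(\<Sum>\<pi>\<in>NC_on {i..<j}. \<Prod>P\<in>\<pi>. f P) = (\<Sum>\<pi>\<in>NC (j - i). \<Prod>P\<in>\<pi>. f ((+) i ` P))"
proof -
  let ?up = "\<lambda>\<pi>. (`) ((+) i) ` \<pi>" and ?down = "\<lambda>\<pi>. (`) (\<lambda>x. x - i) ` \<pi>"
  have up_down: "?up (?down \<pi>) = \<pi>" if "\<pi> \<in> NC_on {i..<j}" for \<pi>
  proof -
    have "(+) i ` (\<lambda>x. x - i) ` P = P" if "P \<in> \<pi>" for P
    proof -
      have "\<forall>x\<in>P. i \<le> x"
        using \<open>\<pi> \<in> _\<close> that by (auto simp: NC_on_def partition_on_def)
      then have "\<forall>x\<in>P. ((+) i \<circ> (\<lambda>x. x - i)) x = x" by simp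
      then show ?thesis by (simp only: image_comp) (simp add: image_def)
    qed
    then show ?thesis by (simp add: image_comp)
  qed
  have down_up: "?down (?up \<pi>) = \<pi>" for \<pi> :: "nat set set"
    by (simp add: image_comp comp_def)
  have up: "?up \<pi> \<in> NC_on {i..<j}" if "\<pi> \<in> NC (j - i)" for \<pi>
  proof -
    have part: "partition_on {..<j - i} \<pi>" and nc: "noncrossing \<pi>"
      using that by (auto simp: NC_def)
    have "partition_on ((+) i ` {..<j - i}) (?up \<pi> - {{}})"
      by (rule partition_on_inj_image[OF part]) simp
    moreover have "{} \<notin> ?up \<pi>"
      using part by (auto simp: partition_on_def)
    moreover have "(+) i ` {..<j - i} = {i..<j}"
      by (cases "i \<le> j") (auto simp: image_add_atLeastLessThan lessThan_atLeast0)
    moreover have "noncrossing (?up \<pi>)"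
      using nc unfolding noncrossing_def by fastforce
    ultimately show ?thesis by (simp add: NC_on_def)
  qed
  have down: "?down \<pi> \<in> NC (j - i)" if "\<pi> \<in> NC_on {i..<j}" for \<pi>
  proof -
    have part: "partition_on {i..<j} \<pi>" and nc: "noncrossing \<pi>"
      using that by (auto simp: NC_on_def)
    have "partition_on ((\<lambda>x. x - i) ` {i..<j}) (?down \<pi> - {{}})"
      by (rule partition_on_inj_image[OF part]) (auto simp: inj_on_def)
    moreover have "{} \<notin> ?down \<pi>"
      using part by (auto simp: partition_on_def)
    moreover have "(\<lambda>x. x - i) ` {i..<j} = {..<j - i}"
      by (auto simp: image_iff) (metis add_diff_cancel_left' atLeastLessThan_iff le_add1 less_diff_conv add.commute)
    moreover have "noncrossing (?down \<pi>)"
      unfolding noncrossing_def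
    proof clarify
      fix P Q a b c d
      assume *: "P \<in> \<pi>" "Q \<in> \<pi>" "a \<in> P" "c \<in> P" "b \<in> Q" "d \<in> Q"
        "a - i < b - i" "b - i < c - i" "c - i < d - i"
        and ne: "(\<lambda>x. x - i) ` P \<noteq> (\<lambda>x. x - i) ` Q"
      have "a < b" "b < c" "c < d" using *(7-9) by linarith+
      then have "P = Q" using noncrossingD[OF nc] *(1-6) by blast
      with ne show False by simp
    qed
    ultimately show ?thesis by (simp add: NC_def)
  qed
  show ?thesis
  proof (rule sum.reindex_bij_witness[of _ ?up ?down])
    fix \<pi> assume \<pi>: "\<pi> \<in> NC_on {i..<j}"
    have "inj_on ((`) ((+) i)) (?down \<pi>)"
      by (rule inj_onI) (simp add: inj_image_eq_iff)
    then have "(\<Prod>P\<in>?down \<pi>. f ((+) i ` P)) = (\<Prod>P\<in>?up (?down \<pi>). f P)"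
      by (simp add: prod.reindex)
    then show "(\<Prod>P\<in>?down \<pi>. f ((+) i ` P)) = (\<Prod>P\<in>\<pi>. f P)"
      using up_down[OF \<pi>] by simp
  qed (use up_down down_up up down in auto)
qed

definition ordered_family :: "nat set set \<Rightarrow> bool" where
  "ordered_family \<J> \<longleftrightarrow> (\<forall>J\<in>\<J>. \<forall>K\<in>\<J>. J \<noteq> K \<longrightarrow>
     (\<forall>x\<in>J. \<forall>y\<in>K. x < y) \<or> (\<forall>x\<in>J. \<forall>y\<in>K. y < x))"

text \<open>
  With the runs of the complement of a set \<open>S\<close> containing \<open>0\<close> for \<open>\<J>\<close>, these are the possible
  completions of the block \<open>S\<close> to a non-crossing partition.
\<close>

definition NC_refining :: "nat set set \<Rightarrow> nat set set set" where
  "NC_refining \<J> = {\<pi> \<in> NC_on (\<Union>\<J>). \<forall>P\<in>\<pi>. \<exists>J\<in>\<J>. P \<subseteq> J}"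

text \<open>
  Restricting \<open>\<pi>\<close> to the members of \<open>\<J>\<close> and taking unions are inverse bijections between
  \<open>NC_refining \<J>\<close> and the families of non-crossing partitions of the members: blocks within
  different members cannot cross, because one member lies entirely to the left of the other.
  The claim is then distributivity of the product over the sums.
\<close>

lemma sum_NC_refining:
  fixes f :: "nat set \<Rightarrow> 'k::comm_semiring_1"
  assumes fin: "finite \<J>" "\<And>J. J \<in> \<J> \<Longrightarrow> finite J" and ord: "ordered_family \<J>"
  shows "(\<Sum>\<pi>\<in>NC_refining \<J>. \<Prod>P\<in>\<pi>. f P) = (\<Prod>J\<in>\<J>. \<Sum>\<rho>\<in>NC_on J. \<Prod>P\<in>\<rho>. f P)"
proof -
  let ?restr = "\<lambda>\<pi>. \<lambda>J\<in>\<J>. {P\<in>\<pi>. P \<subseteq> J}"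
  let ?union = "\<lambda>g. \<Union>J\<in>\<J>. g J"
  have disj: "J \<inter> K = {}" if "J \<in> \<J>" "K \<in> \<J>" "J \<noteq> K" for J K
    using ord that unfolding ordered_family_def by fastforce
  have same: "J = K" if "J \<in> \<J>" "K \<in> \<J>" "P \<subseteq> J" "P \<subseteq> K" "P \<noteq> {}" for J K P
    using disj[of J K] that by blast
  have block: "P \<subseteq> J" "P \<noteq> {}" if "g \<in> PiE \<J> NC_on" "J \<in> \<J>" "P \<in> g J" for g J P
    using that by (auto simp: PiE_iff NC_on_def partition_on_def)
  have union: "?union g \<in> NC_refining \<J>" if g: "g \<in> PiE \<J> NC_on" for g
  proof -
    have gJ: "partition_on J (g J)" "noncrossing (g J)" if "J \<in> \<J>" for J
      using g that by (auto simp: PiE_iff NC_on_def)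
    have "partition_on (\<Union>\<J>) (?union g)"
    proof (rule partition_onI)
      show "\<Union> (?union g) = \<Union>\<J>"
      proof -
        have "\<Union>(?union g) = (\<Union>J\<in>\<J>. \<Union>(g J))" by blast
        also have "\<dots> = (\<Union>J\<in>\<J>. J)"
          using partition_onD1[OF gJ(1)] by (intro SUP_cong) auto
        finally show ?thesis by simp
      qed
      show "disjnt P Q" if "P \<in> ?union g" "Q \<in> ?union g" "P \<noteq> Q" for P Q
      proof -
        from that obtain J K where JK: "J \<in> \<J>" "P \<in> g J" "K \<in> \<J>" "Q \<in> g K" by blast
        show ?thesis
        proof (cases "J = K")
          case True
          then show ?thesis
            using JK gJ(1)[of J] \<open>P \<noteq> Q\<close> by (auto simp: partition_on_def disjoint_def disjnt_def)
        next
          case False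
          then show ?thesis
            using disj[OF JK(1,3)] block(1)[OF g JK(1,2)] block(1)[OF g JK(3,4)]
            unfolding disjnt_def by blast
        qed
      qed
      show "{} \<notin> ?union g"
        using block[OF g] by blast
    qed
    moreover have "noncrossing (?union g)"
      unfolding noncrossing_def
    proof clarify
      fix a b c d P Q J K
      assume *: "a < b" "b < c" "c < d" "P \<noteq> Q" "a \<in> P" "c \<in> P" "b \<in> Q" "d \<in> Q"
        "J \<in> \<J>" "P \<in> g J" "K \<in> \<J>" "Q \<in> g K"
      have "a \<in> J" "c \<in> J" "b \<in> K" using * block[OF g] by blast+
      have "J = K"
      proof (rule ccontr)
        assume "J \<noteq> K"
        then have "(\<forall>x\<in>J. \<forall>y\<in>K. x < y) \<or> (\<forall>x\<in>J. \<forall>y\<in>K. y < x)"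
          using ord *(9,11) by (simp add: ordered_family_def)
        then have "c < b \<or> b < a"
          using \<open>a \<in> J\<close> \<open>b \<in> K\<close> \<open>c \<in> J\<close> by blast
        then show False using *(1,2) by simp
      qed
      then show False
        using noncrossingD[of "g J" P Q a c b d] gJ(2) * by blast
    qed
    ultimately show ?thesis
      using block[OF g] by (fastforce simp: NC_refining_def NC_on_def)
  qed
  have restr: "?restr \<pi> \<in> PiE \<J> NC_on" if \<pi>: "\<pi> \<in> NC_refining \<J>" for \<pi>
  proof (rule PiE_I)
    fix J assume J: "J \<in> \<J>"
    have part: "partition_on (\<Union>\<J>) \<pi>" and nc: "noncrossing \<pi>"
      and ref: "\<And>P. P \<in> \<pi> \<Longrightarrow> \<exists>J\<in>\<J>. P \<subseteq> J"
      using \<pi> by (auto simp: NC_refining_def NC_on_def)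
    have "x \<in> \<Union>{P \<in> \<pi>. P \<subseteq> J}" if "x \<in> J" for x
    proof -
      have "x \<in> \<Union>\<J>" using J that by blast
      then have "x \<in> \<Union>\<pi>" using partition_onD1[OF part] by simp
      then obtain P where P: "P \<in> \<pi>" "x \<in> P" by blast
      moreover obtain K where "K \<in> \<J>" "P \<subseteq> K" using ref P by blast
      ultimately show ?thesis using disj[of J K] J that by blast
    qed
    then have "partition_on J {P \<in> \<pi>. P \<subseteq> J}"
      using part by (auto simp: partition_on_def disjoint_def)
    then show "?restr \<pi> J \<in> NC_on J"
      using J noncrossing_mono[OF nc] by (auto simp: NC_on_def)
  qed auto
  have "(\<Prod>J\<in>\<J>. \<Sum>\<rho>\<in>NC_on J. \<Prod>P\<in>\<rho>. f P) =
      (\<Sum>g\<in>PiE \<J> NC_on. \<Prod>J\<in>\<J>. \<Prod>P\<in>g J. f P)"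
    using fin by (intro prod_sum_PiE) (auto intro: finite_NC_on)
  also have "\<dots> = (\<Sum>\<pi>\<in>NC_refining \<J>. \<Prod>P\<in>\<pi>. f P)"
  proof (rule sum.reindex_bij_witness[of _ ?restr ?union])
    fix g assume g: "g \<in> PiE \<J> NC_on"
    show "?restr (?union g) = g"
    proof
      fix J
      show "?restr (?union g) J = g J"
      proof (cases "J \<in> \<J>")
        case True
        have "P \<in> g J" if "K \<in> \<J>" "P \<in> g K" "P \<subseteq> J" for K P
          using same[of J K P] that True block[OF g] by blast
        then have "{P \<in> ?union g. P \<subseteq> J} = g J"
          using True block(1)[OF g True] by blast
        then show ?thesis using True by simp
      next
        case False
        then show ?thesis using g by (auto simp: PiE_iff extensional_def)
      qed
    qed
    show "(\<Prod>P\<in>?union g. f P) = (\<Prod>J\<in>\<J>. \<Prod>P\<in>g J. f P)"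
    proof (rule prod.UNION_disjoint)
      show "\<forall>J\<in>\<J>. finite (g J)"
        using g fin(2) finite_elements by (fastforce simp: PiE_iff NC_on_def)
      show "\<forall>J\<in>\<J>. \<forall>K\<in>\<J>. J \<noteq> K \<longrightarrow> g J \<inter> g K = {}"
      proof (intro ballI impI equals0I)
        fix J K P assume "J \<in> \<J>" "K \<in> \<J>" "J \<noteq> K" "P \<in> g J \<inter> g K"
        then show False
          using same[of J K P] block[OF g, of J P] block[OF g, of K P] by simp
      qed
    qed (rule fin(1))
  next
    fix \<pi> assume \<pi>: "\<pi> \<in> NC_refining \<J>"
    show "?union (?restr \<pi>) = \<pi>"
      using \<pi> by (auto simp: NC_refining_def)
  qed (use union restr in auto)
  finally show ?thesis by simp
qed

section \<open>Splitting off the block of the first letter\<close>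

text \<open>
  The blocks within one run do not cross \<open>S\<close>, as there is no element of \<open>S\<close> between two elements of a
  run. That every block of a non-crossing completion lies within a run rests on \<open>0 \<in> S\<close>: otherwise
  a block could enclose all of \<open>S\<close>.
\<close>

lemma NC_insert_iff:
  assumes S: "0 \<in> S" "S \<subseteq> {..<n}"
  defines "X \<equiv> {..<n} - S"
  assumes "S \<notin> \<rho>"
  shows "insert S \<rho> \<in> NC n \<longleftrightarrow> \<rho> \<in> NC_refining (run_from X ` run_starts X)"
proof
  assume "insert S \<rho> \<in> NC n"
  then have part: "partition_on {..<n} (insert S \<rho>)" and nc: "noncrossing (insert S \<rho>)"
    by (auto simp: NC_def)
  have part': "partition_on X \<rho>"
    using part \<open>S \<notin> \<rho>\<close> by (fastforce simp: partition_on_def disjoint_def X_def)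
  \<comment> \<open>A block jumping over an element of \<open>S\<close> would cross \<open>S\<close>, which also contains \<open>0\<close>.\<close>
  have "\<exists>J\<in>run_from X ` run_starts X. P \<subseteq> J" if P: "P \<in> \<rho>" for P
  proof -
    have PX: "P \<subseteq> X" "P \<noteq> {}" using part' P by (auto simp: partition_on_def)
    define p where "p = (LEAST p. p \<in> P)"
    have p: "p \<in> P" "\<And>x. x \<in> P \<Longrightarrow> p \<le> x"
      using PX(2) by (auto simp: p_def Least_le intro: LeastI)
    obtain i where i: "i \<in> run_starts X" "p \<in> run_from X i"
      using Union_runs[of X] p(1) PX(1) by blast
    have "x \<in> run_from X i" if x: "x \<in> P" for x
    proof -
      have "z \<in> X" if z: "p \<le> z" "z \<le> x" for z
      proof (rule ccontr)
        assume "z \<notin> X"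
        then have "z \<in> S" using x PX(1) z by (auto simp: X_def)
        moreover have "0 < p" using p(1) PX(1) S(1) by (auto simp: X_def intro: gr0I)
        moreover have "p \<noteq> z" "z \<noteq> x" using \<open>z \<notin> X\<close> p(1) x PX(1) by blast+
        ultimately have "S = P"
          using noncrossingD[OF nc, of S P 0 z p x] S(1) P p(1) x z by auto
        then show False using \<open>S \<notin> \<rho>\<close> P by simp
      qed
      then show ?thesis
        using i(2) p(2)[OF x] by (auto simp: run_from_def subset_iff) (meson nat_le_linear)
    qed
    then show ?thesis using i(1) by blast
  qed
  then show "\<rho> \<in> NC_refining (run_from X ` run_starts X)"
    using part' noncrossing_mono[OF nc] by (auto simp: NC_refining_def NC_on_def Union_runs)
next
  assume "\<rho> \<in> NC_refining (run_from X ` run_starts X)"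
  then have part: "partition_on X \<rho>" and nc: "noncrossing \<rho>"
    and ref: "\<And>P. P \<in> \<rho> \<Longrightarrow> \<exists>i. P \<subseteq> run_from X i"
    by (auto simp: NC_refining_def NC_on_def Union_runs)
  have "partition_on {..<n} (insert S \<rho>)"
  proof -
    have "disjnt S (\<Union>\<rho>)"
      using partition_onD1[OF part] by (auto simp: disjnt_def X_def)
    then show ?thesis using part S by (auto simp: partition_on_insert X_def)
  qed
  moreover have no_gap: False if "P \<in> \<rho>" "x \<in> P" "y \<in> P" "z \<in> S" "x < z" "z < y" for P x y z
    using ref[OF that(1)] that run_from_convex[of x X _ y z] by (fastforce simp: X_def)
  have "noncrossing (insert S \<rho>)"
    unfolding noncrossing_def
  proof clarify
    fix a b c d P Q
    assume *: "P \<in> insert S \<rho>" "Q \<in> insert S \<rho>" "P \<noteq> Q" "a \<in> P" "c \<in> P" "b \<in> Q" "d \<in> Q"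
      "a < b" "b < c" "c < d"
    then consider "P \<in> \<rho>" "Q \<in> \<rho>" | "P \<in> \<rho>" "Q = S" | "P = S" "Q \<in> \<rho>" by blast
    then show False
    proof cases
      case 1
      then show ?thesis using noncrossingD[OF nc, of P Q a c b d] * by blast
    next
      case 2
      then show ?thesis using no_gap[of P a c b] * by blast
    next
      case 3
      then show ?thesis using no_gap[of Q b d c] * by blast
    qed
  qed
  ultimately show "insert S \<rho> \<in> NC n" by (simp add: NC_def)
qed

text \<open>
  The map sending \<open>\<pi>\<close> to its block \<open>S\<close> containing \<open>0\<close> and the set of the remaining blocks is a
  bijection onto the pairs described by \<open>NC_insert_iff\<close>.
\<close>

lemma sum_NC_first_block:
  fixes f :: "nat set \<Rightarrow> 'k::comm_semiring_1"
  assumes "0 < n"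
  shows "(\<Sum>\<pi>\<in>NC n. \<Prod>P\<in>\<pi>. f P) =
    (\<Sum>S | 0 \<in> S \<and> S \<subseteq> {..<n}.
      f S * (\<Prod>J\<leftarrow>runs ({..<n} - S). \<Sum>\<rho>\<in>NC_on J. \<Prod>P\<in>\<rho>. f P))"
proof -
  let ?I = "{S. 0 \<in> S \<and> S \<subseteq> {..<n}}"
  let ?J = "\<lambda>S. run_from ({..<n} - S) ` run_starts ({..<n} - S)"
  let ?first = "\<lambda>\<pi>. THE P. P \<in> \<pi> \<and> 0 \<in> P"
  have finI: "finite ?I"
    by (rule finite_subset[of _ "Pow {..<n}"]) auto
  have in_refining: "partition_on ({..<n} - S) \<rho>" if "\<rho> \<in> NC_refining (?J S)" for S \<rho>
    using that by (simp add: NC_refining_def NC_on_def Union_runs)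
  have notin: "S \<notin> \<rho>" if "S \<in> ?I" "\<rho> \<in> NC_refining (?J S)" for S \<rho>
    using in_refining[OF that(2)] that(1) by (auto simp: partition_on_def)
  have finref: "finite (NC_refining (?J S))" for S
    by (rule finite_subset[OF _ finite_NC_on[of "{..<n} - S"]])
      (auto simp: NC_refining_def Union_runs)
  have first: "?first \<pi> \<in> \<pi>" "?first \<pi> \<in> ?I" if "\<pi> \<in> NC n" for \<pi>
  proof -
    have part: "partition_on {..<n} \<pi>" using that by (simp add: NC_def)
    then obtain P where P: "P \<in> \<pi>" "0 \<in> P"
      using assms by (auto simp: partition_on_def)
    then have "?first \<pi> = P"
      using partition_block_unique[OF part] by (intro the_equality) auto
    with P part show "?first \<pi> \<in> \<pi>" "?first \<pi> \<in> ?I"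
      by (auto simp: partition_on_def)
  qed
  have first_insert: "?first (insert S \<rho>) = S" if "S \<in> ?I" "\<rho> \<in> NC_refining (?J S)" for S \<rho>
    using that in_refining[OF that(2)] by (intro the_equality) (auto simp: partition_on_def)
  have split: "(\<Sum>\<rho>\<in>NC_refining (?J S). \<Prod>P\<in>\<rho>. f P) =
      (\<Prod>J\<leftarrow>runs ({..<n} - S). \<Sum>\<rho>\<in>NC_on J. \<Prod>P\<in>\<rho>. f P)" for S
  proof -
    have "ordered_family (?J S)"
      unfolding ordered_family_def
    proof (intro ballI impI)
      fix J K assume "J \<in> ?J S" "K \<in> ?J S" "J \<noteq> K"
      then obtain i k where "i \<in> run_starts ({..<n} - S)" "k \<in> run_starts ({..<n} - S)" "i \<noteq> k"
        "J = run_from ({..<n} - S) i" "K = run_from ({..<n} - S) k"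
        by blast
      then show "(\<forall>x\<in>J. \<forall>y\<in>K. x < y) \<or> (\<forall>x\<in>J. \<forall>y\<in>K. y < x)"
        using runs_ordered by (metis linorder_neqE_nat)
    qed
    moreover have "finite J" if "J \<in> ?J S" for J
      using that run_from_subset[of "{..<n} - S"] by (blast intro: finite_subset[of _ "{..<n}"])
    ultimately show ?thesis
      by (simp add: sum_NC_refining prod_list_runs finite_run_starts)
  qed
  have "(\<Sum>\<pi>\<in>NC n. \<Prod>P\<in>\<pi>. f P) =
      (\<Sum>(S, \<rho>)\<in>(SIGMA S:?I. NC_refining (?J S)). f S * (\<Prod>P\<in>\<rho>. f P))"
  proof (rule sum.reindex_bij_witness
      [of _ "\<lambda>(S, \<rho>). insert S \<rho>" "\<lambda>\<pi>. (?first \<pi>, \<pi> - {?first \<pi>})"])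
    fix \<pi> assume \<pi>: "\<pi> \<in> NC n"
    show "(case (?first \<pi>, \<pi> - {?first \<pi>}) of (S, \<rho>) \<Rightarrow> insert S \<rho>) = \<pi>"
      using first(1)[OF \<pi>] by auto
    show "(?first \<pi>, \<pi> - {?first \<pi>}) \<in> (SIGMA S:?I. NC_refining (?J S))"
      using first[OF \<pi>] \<pi> NC_insert_iff[of "?first \<pi>" n "\<pi> - {?first \<pi>}"]
      by (simp add: insert_absorb)
    have "finite \<pi>"
      using \<pi> finite_elements[of "{..<n}" \<pi>] by (simp add: NC_def)
    then show "(case (?first \<pi>, \<pi> - {?first \<pi>}) of (S, \<rho>) \<Rightarrow> f S * (\<Prod>P\<in>\<rho>. f P)) =
        (\<Prod>P\<in>\<pi>. f P)"
      using first(1)[OF \<pi>] by (simp add: prod.remove)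
  next
    fix q assume "q \<in> (SIGMA S:?I. NC_refining (?J S))"
    then obtain S \<rho> where q: "q = (S, \<rho>)" and S: "S \<in> ?I" and \<rho>: "\<rho> \<in> NC_refining (?J S)"
      by blast
    show "(?first (case q of (S, \<rho>) \<Rightarrow> insert S \<rho>),
        (case q of (S, \<rho>) \<Rightarrow> insert S \<rho>) - {?first (case q of (S, \<rho>) \<Rightarrow> insert S \<rho>)}) = q"
      using notin[OF S \<rho>] first_insert[OF S \<rho>] by (simp add: q)
    show "(case q of (S, \<rho>) \<Rightarrow> insert S \<rho>) \<in> NC n"
      using NC_insert_iff[of S n \<rho>] S \<rho> notin[OF S \<rho>] by (simp add: q)
  qed
  also have "\<dots> = (\<Sum>S\<in>?I. f S * (\<Sum>\<rho>\<in>NC_refining (?J S). \<Prod>P\<in>\<rho>. f P))"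
    using finI finref by (simp add: sum.Sigma[symmetric] sum_distrib_left)
  finally show ?thesis by (simp add: split)
qed

section \<open>The common recursion\<close>

lemma nths_interval:
  assumes "B \<subseteq> {..<j - i}"
  shows "nths (nths xs {i..<j}) B = nths xs ((+) i ` B)"
proof -
  have "card {k \<in> {i..<j}. k < a} = a - i" if "a < j" for a
  proof -
    have "{k \<in> {i..<j}. k < a} = {i..<a}" using that by auto
    then show ?thesis by simp
  qed
  then have "{a \<in> {i..<j}. \<exists>b\<in>B. card {k \<in> {i..<j}. k < a} = b} = {a \<in> {i..<j}. a - i \<in> B}"
    by auto
  also have "\<dots> = (+) i ` B"
  proof (intro set_eqI iffI)
    fix a assume "a \<in> {a \<in> {i..<j}. a - i \<in> B}"
    then have "a = i + (a - i)" "a - i \<in> B" by auto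
    then show "a \<in> (+) i ` B" by (rule image_eqI)
  qed (use assms in force)
  finally have "{a \<in> {i..<j}. \<exists>b\<in>B. card {k \<in> {i..<j}. k < a} = b} = (+) i ` B" .
  then show ?thesis by (simp add: nths_nths)
qed

lemma nths_eq_Nil_iff: "nths xs S = [] \<longleftrightarrow> S \<inter> {..<length xs} = {}"
  by (auto simp: set_nths simp flip: set_empty)

lemma runs_nonempty: "finite X \<Longrightarrow> J \<in> set (runs X) \<Longrightarrow> J \<noteq> {} \<and> J \<subseteq> X"
  using run_start_in_run run_from_subset by (fastforce simp: runs_def finite_run_starts)

text \<open>
  Shifting identifies the partitions of an interval of positions in \<open>as\<close> with the partitions of the
  positions of the factor of \<open>as\<close> on that interval, so that the moment-cumulant formula of the
  factor applies.
\<close>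

lemma moment_sum_on_interval:
  fixes R :: "('a word \<Rightarrow>\<^sub>0 'k::field) \<Rightarrow> 'k"
  assumes "{i..<j} \<subseteq> {..<length as}"
  shows "(\<Sum>\<rho>\<in>NC_on {i..<j}. \<Prod>P\<in>\<rho>. R (basis (word (nths as P)))) =
    (\<Sum>\<pi>\<in>NC (length (nths as {i..<j})). partition_form R \<pi> (nths as {i..<j}))"
proof -
  have "{k. k < length as \<and> k \<in> {i..<j}} = {i..<j}" using assms by auto
  then have len: "length (nths as {i..<j}) = j - i"
    by (simp add: length_nths)
  show ?thesis
    unfolding sum_NC_on_shift len partition_form_def
  proof (intro sum.cong prod.cong refl)
    fix \<pi> P assume "\<pi> \<in> NC (j - i)" "P \<in> \<pi>"
    then have "P \<subseteq> {..<j - i}" by (auto simp: NC_def partition_on_def)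
    then show "R (basis (word (nths as ((+) i ` P)))) =
        R (basis (word (nths (nths as {i..<j}) P)))"
      by (simp add: nths_interval)
  qed
qed

lemma cumulant_recursion:
  fixes R :: "('a word \<Rightarrow>\<^sub>0 'k::field) \<Rightarrow> 'k"
  assumes moments: "\<And>as. as \<noteq> [] \<Longrightarrow>
      M as = (\<Sum>\<pi>\<in>NC (length as). partition_form R \<pi> as)"
    and "as \<noteq> []"
  shows "M as = (\<Sum>S | 0 \<in> S \<and> S \<subseteq> {..<length as}.
    R (basis (word (nths as S))) * (\<Prod>J\<leftarrow>runs ({..<length as} - S). M (nths as J)))"
proof -
  let ?f = "\<lambda>P. R (basis (word (nths as P)))"
  have run: "(\<Sum>\<rho>\<in>NC_on J. \<Prod>P\<in>\<rho>. ?f P) = M (nths as J)"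
    if J: "J \<in> set (runs ({..<length as} - S))" for J S
  proof -
    have ne: "J \<noteq> {}" "J \<subseteq> {..<length as}"
      using runs_nonempty[OF _ J] by auto
    obtain i where "J = run_from ({..<length as} - S) i"
      using J by (auto simp: runs_def finite_run_starts)
    then obtain j where ij: "J = {i..<j}"
      using run_from_eq_interval[of "{..<length as} - S" i] by auto
    have "nths as J \<noteq> []" using ne by (auto simp: nths_eq_Nil_iff)
    then show ?thesis
      using moment_sum_on_interval[of i j as R] ne(2) moments[of "nths as J"] by (simp add: ij)
  qed
  have "M as = (\<Sum>\<pi>\<in>NC (length as). \<Prod>P\<in>\<pi>. ?f P)"
    using moments[OF \<open>as \<noteq> []\<close>] by (simp add: partition_form_def)
  also have "\<dots> = (\<Sum>S | 0 \<in> S \<and> S \<subseteq> {..<length as}.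
      ?f S * (\<Prod>J\<leftarrow>runs ({..<length as} - S). \<Sum>\<rho>\<in>NC_on J. \<Prod>P\<in>\<rho>. ?f P))"
    using \<open>as \<noteq> []\<close> by (intro sum_NC_first_block) simp
  also have "\<dots> = (\<Sum>S | 0 \<in> S \<and> S \<subseteq> {..<length as}.
      ?f S * (\<Prod>J\<leftarrow>runs ({..<length as} - S). M (nths as J)))"
    by (intro sum.cong refl arg_cong2[where f = "(*)"] arg_cong[where f = prod_list] map_cong run)
  finally show ?thesis .
qed

text \<open>
  On a single word the augmentation vanishes, and \<open>\<Phi>\<close> turns the bar word of the runs into a product
  of moments.
\<close>

lemma half_conv_recursion:
  fixes \<kappa> :: "('a::ring_1 word list \<Rightarrow>\<^sub>0 'k::field) \<Rightarrow> 'k"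
  assumes solution: "\<And>x. ext_TT \<phi> x = augmentation x + half_conv \<kappa> (ext_TT \<phi>) x"
    and "as \<noteq> []"
  shows "ext_T \<phi> (basis (word as)) = (\<Sum>S | 0 \<in> S \<and> S \<subseteq> {..<length as}.
    \<kappa> (basis [word (nths as S)]) *
    (\<Prod>J\<leftarrow>runs ({..<length as} - S). ext_T \<phi> (basis (word (nths as J)))))"
proof -
  have eval: "ext_TT \<phi> (basis ws) = (\<Prod>w\<leftarrow>ws. ext_T \<phi> (basis w))" for ws
    by (simp add: ext_TT_def lin_ext_basis)
  have letters: "letters (word as) = as"
    using \<open>as \<noteq> []\<close> by (simp add: word_inverse)
  have sub: "subword as S = [word (nths as S)]" if "0 \<in> S" for S
    using that \<open>as \<noteq> []\<close> by (auto simp: subword_def nths_eq_Nil_iff)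
  have "ext_T \<phi> (basis (word as)) = half_conv \<kappa> (ext_TT \<phi>) (basis [word as])"
    using solution[of "basis [word as]"]
    by (simp add: eval augmentation_def) (simp add: basis_def lookup_single)
  also have "\<dots> = (\<Sum>S | 0 \<in> S \<and> S \<subseteq> {..<length as}.
      \<kappa> (basis [word (nths as S)]) *
      (\<Prod>J\<leftarrow>runs ({..<length as} - S). ext_T \<phi> (basis (word (nths as J)))))"
    by (subst half_conv_single_word)
      (auto simp: eval letters subword_tensor_def sub comp_def intro!: sum.cong)
  finally show ?thesis .
qed

text \<open>
  The right-hand side determines \<open>f as\<close> from shorter words: the full set \<open>S\<close> has no complement and
  contributes \<open>f as\<close> with coefficient \<open>1\<close>.
\<close>

lemma first_block_recursion_unique:
  fixes f g M :: "'a list \<Rightarrow> 'k::field"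
  assumes f: "\<And>as. as \<noteq> [] \<Longrightarrow> M as = (\<Sum>S | 0 \<in> S \<and> S \<subseteq> {..<length as}.
      f (nths as S) * (\<Prod>J\<leftarrow>runs ({..<length as} - S). M (nths as J)))"
    and g: "\<And>as. as \<noteq> [] \<Longrightarrow> M as = (\<Sum>S | 0 \<in> S \<and> S \<subseteq> {..<length as}.
      g (nths as S) * (\<Prod>J\<leftarrow>runs ({..<length as} - S). M (nths as J)))"
    and "as \<noteq> []"
  shows "f as = g as"
  using \<open>as \<noteq> []\<close>
proof (induction as rule: length_induct)
  case (1 as)
  let ?n = "length as"
  let ?I = "{S. 0 \<in> S \<and> S \<subseteq> {..<?n}}"
  let ?m = "\<lambda>S. \<Prod>J\<leftarrow>runs ({..<?n} - S). M (nths as J)"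
  have fin: "finite ?I"
    by (rule finite_subset[of _ "Pow {..<?n}"]) auto
  have full: "{..<?n} \<in> ?I" using 1 by auto
  have expand: "M as = h as + (\<Sum>S\<in>?I - {{..<?n}}. h (nths as S) * ?m S)"
    if "M as = (\<Sum>S\<in>?I. h (nths as S) * ?m S)" for h
    unfolding that sum.remove[OF fin full] by (simp add: runs_def run_starts_def)
  have "f (nths as S) = g (nths as S)" if "S \<in> ?I - {{..<?n}}" for S
  proof -
    have "S \<subset> {..<?n}" using that by auto
    moreover have "{k. k < ?n \<and> k \<in> S} = S" using that by auto
    ultimately have "length (nths as S) < ?n"
      using psubset_card_mono[of "{..<?n}" S] by (simp add: length_nths)
    moreover have "nths as S \<noteq> []"
      using that by (auto simp: nths_eq_Nil_iff)
    ultimately show ?thesis using 1 by blast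
  qed
  then have "(\<Sum>S\<in>?I - {{..<?n}}. f (nths as S) * ?m S) =
      (\<Sum>S\<in>?I - {{..<?n}}. g (nths as S) * ?m S)"
    by (intro sum.cong) auto
  then show ?case
    using expand[OF f] expand[OF g] 1 by simp
qed

theorem theorem9:
  fixes scale :: "'k::field_char_0 \<Rightarrow> 'a::ring_1 \<Rightarrow> 'a"
    and \<phi> :: "'a \<Rightarrow> 'k"
    and \<kappa> :: "('a word list \<Rightarrow>\<^sub>0 'k) \<Rightarrow> 'k"
    and R :: "('a word \<Rightarrow>\<^sub>0 'k) \<Rightarrow> 'k"
  assumes "unital_algebra scale"
    and "Vector_Spaces.linear scale (*) \<phi>" and "\<phi> 1 = 1"
    and "infinitesimal_character scale \<kappa>"
    and "\<And>x. ext_TT \<phi> x = augmentation x + half_conv \<kappa> (ext_TT \<phi>) x"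
    and "noncrossing_cumulants scale \<phi> R"
  shows "\<forall>as :: 'a list. as \<noteq> [] \<longrightarrow> \<kappa> (basis [word as]) = R (basis (word as))"
proof (intro allI impI)
  fix as :: "'a list" assume "as \<noteq> []"
  have moments: "ext_T \<phi> (basis (word bs)) = (\<Sum>\<pi>\<in>NC (length bs). partition_form R \<pi> bs)"
    if "bs \<noteq> []" for bs
    using assms(6) that by (simp add: noncrossing_cumulants_def)
  show "\<kappa> (basis [word as]) = R (basis (word as))"
    by (rule first_block_recursion_unique[where M = "\<lambda>bs. ext_T \<phi> (basis (word bs))"
          and f = "\<lambda>bs. \<kappa> (basis [word bs])" and g = "\<lambda>bs. R (basis (word bs))",
          OF half_conv_recursion[OF assms(5)] cumulant_recursion[OF moments] \<open>as \<noteq> []\<close>])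
qed

end
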